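(* Let $R$ be a super Dedekind complete and weakly $\sigma$-distributive lattice group, $G$ an infinite set, $\mathcal{L}$ an algebra of subsets of $G$ satisfying property $(E)$, and $m:\mathcal{L}\to R$ any positive bounded $(s)$-bounded set function. Then for every disjoint sequence $(C_n)_n$ in $\mathcal{L}$ there exists a subsequence $(C_{n_h})_h$ such that $m$ is continuous from above at $\emptyset$ on the $\sigma$-algebra generated by $(C_{n_h})_h$ in the set $\bigcup_{h=1}^\infty C_{n_h}$ (this $\sigma$-algebra being contained in $\mathcal{L}$).
   Context: A lattice group is Dedekind complete if every nonempty subset bounded from above has a supremum; it is super Dedekind complete if moreover every nonempty $A\subset R$ bounded from above has a countable subset $A'$ with $\bigvee A'=\bigvee A$. A sequence $(\sigma_p)_p$ in $R$ is an $(O)$-sequence if it is decreasing and $\bigwedge_p\sigma_p=0$. A bounded double sequence $(a_{t,l})_{t,l}$ in $R$ is a $(D)$-sequence (or regulator) if $(a_{t,l})_l$ is an $(O)$-sequence for every $t\in\mathbb{N}$. $R$ is weakly $\sigma$-distributive if $\bigwedge_{\varphi\in\mathbb{N}^{\mathbb{N}}}\bigl(\bigvee_{t=1}^\infty a_{t,\varphi(t)}\bigr)=0$ for every $(D)$-sequence $(a_{t,l})_{t,l}$ in $R$. $(D)\lim_n x_n=x$ with respect to a regulator $(a_{t,l})_{t,l}$ means: for every $\varphi\in\mathbb{N}^{\mathbb{N}}$ there is $n_0$ with $|x_n-x|\le\bigvee_{t=1}^\infty a_{t,\varphi(t)}$ for all $n\ge n_0$. Property $(E)$: every disjoint sequence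 $(C_h)_h$ in $\mathcal{L}$ has a subsequence $(C_{h_r})_r$ such that $\mathcal{L}$ contains the $\sigma$-algebra generated by the sets $C_{h_r}$, $r\in\mathbb{N}$, in the set $\bigcup_r C_{h_r}$. $m$ positive bounded means there is $w\in R$ with $0\le m(A)\le w$ for all $A\in\mathcal{L}$. $m$ is $(s)$-bounded if there is a $(D)$-sequence with respect to which $(D)\lim_h m(C_h)=0$ for every disjoint sequence $(C_h)_h$ in $\mathcal{L}$. $m$ is continuous from above at $\emptyset$ on a family $\mathcal{A}\subset\mathcal{L}$ if there is a $(D)$-sequence with respect to which $(D)\lim_n m(H_n)=0$ for every decreasing sequence $(H_n)_n$ in $\mathcal{A}$ with $\bigcap_n H_n=\emptyset$. *)

theory Defs
  imports "HOL-Analysis.Sigma_Algebra" "HOL-Library.Lattice_Algebras"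
begin

text \<open>
  Lattice groups are written additively and are commutative. A Dedekind complete lattice group is
  a type in the classes \<open>lattice_ab_group_add_abs\<close> (so that \<open>\<bar>x\<bar> = sup x (- x)\<close>) and
  \<open>conditionally_complete_lattice\<close>, in which \<open>Sup\<close> and \<open>Inf\<close> are specified exactly on the nonempty
  sets bounded from above and from below respectively; every \<open>Sup\<close> and \<open>Inf\<close> below is either
  guarded by such a bound or taken over a bounded family. Sequences are indexed from 0.
\<close>

class dedekind_complete_lattice_group =
  lattice_ab_group_add_abs + conditionally_complete_lattice

definition super_dedekind_complete :: "'r::dedekind_complete_lattice_group itself \<Rightarrow> bool" where
  "super_dedekind_complete _ \<longleftrightarrow>
     (\<forall>A::'r set. A \<noteq> {} \<longrightarrow> bdd_above A \<longrightarrow>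
        (\<exists>A'. A' \<subseteq> A \<and> A' \<noteq> {} \<and> countable A' \<and> Sup A' = Sup A))"

definition O_sequence :: "(nat \<Rightarrow> 'r::dedekind_complete_lattice_group) \<Rightarrow> bool" where
  "O_sequence \<sigma> \<longleftrightarrow> decseq \<sigma> \<and> bdd_below (range \<sigma>) \<and> (INF p. \<sigma> p) = 0"

definition D_sequence :: "(nat \<Rightarrow> nat \<Rightarrow> 'r::dedekind_complete_lattice_group) \<Rightarrow> bool" where
  "D_sequence a \<longleftrightarrow> (\<exists>u. \<forall>t l. \<bar>a t l\<bar> \<le> u) \<and> (\<forall>t. O_sequence (a t))"

text \<open>The infimum over \<open>\<phi>\<close> exists because the terms of a (D)-sequence are nonnegative.\<close>

definition weakly_sigma_distributive :: "'r::dedekind_complete_lattice_group itself \<Rightarrow> bool" where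
  "weakly_sigma_distributive _ \<longleftrightarrow>
     (\<forall>a::nat \<Rightarrow> nat \<Rightarrow> 'r. D_sequence a \<longrightarrow>
        (INF \<phi>::nat \<Rightarrow> nat. SUP t. a t (\<phi> t)) = 0)"

definition D_lim ::
    "(nat \<Rightarrow> nat \<Rightarrow> 'r::dedekind_complete_lattice_group) \<Rightarrow> (nat \<Rightarrow> 'r) \<Rightarrow> 'r \<Rightarrow> bool" where
  "D_lim a x l \<longleftrightarrow>
     (\<forall>\<phi>::nat \<Rightarrow> nat. \<exists>n0. \<forall>n\<ge>n0. \<bar>x n - l\<bar> \<le> (SUP t. a t (\<phi> t)))"

definition property_E :: "'g set set \<Rightarrow> bool" where
  "property_E L \<longleftrightarrow>
     (\<forall>C::nat \<Rightarrow> 'g set. range C \<subseteq> L \<longrightarrow> disjoint_family C \<longrightarrow>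
        (\<exists>h::nat \<Rightarrow> nat. strict_mono h \<and>
           sigma_sets (\<Union>r. C (h r)) (range (\<lambda>r. C (h r))) \<subseteq> L))"

text \<open>
  A set function on \<open>L\<close> is a total function of which only the values on \<open>L\<close> are used. It need be
  neither additive nor monotone.
\<close>

definition positive_bounded ::
    "'g set set \<Rightarrow> ('g set \<Rightarrow> 'r::dedekind_complete_lattice_group) \<Rightarrow> bool" where
  "positive_bounded L m \<longleftrightarrow> (\<exists>w. \<forall>A\<in>L. 0 \<le> m A \<and> m A \<le> w)"

text \<open>In the next two definitions one regulator serves all sequences of sets.\<close>

definition s_bounded ::
    "'g set set \<Rightarrow> ('g set \<Rightarrow> 'r::dedekind_complete_lattice_group) \<Rightarrow> bool" where
  "s_bounded L m \<longleftrightarrow>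
     (\<exists>a. D_sequence a \<and>
        (\<forall>C::nat \<Rightarrow> 'g set. range C \<subseteq> L \<longrightarrow> disjoint_family C \<longrightarrow> D_lim a (\<lambda>h. m (C h)) 0))"

definition continuous_from_above_at_empty_on ::
    "'g set set \<Rightarrow> ('g set \<Rightarrow> 'r::dedekind_complete_lattice_group) \<Rightarrow> bool" where
  "continuous_from_above_at_empty_on \<A> m \<longleftrightarrow>
     (\<exists>a. D_sequence a \<and>
        (\<forall>H::nat \<Rightarrow> 'g set. range H \<subseteq> \<A> \<longrightarrow> decseq H \<longrightarrow> (\<Inter>n. H n) = {} \<longrightarrow>
           D_lim a (\<lambda>n. m (H n)) 0))"

end

theory Submission
  imports Defs "HOL-Library.Diagonal_Subsequence" "HOL-Library.Nat_Bijection"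
begin

text \<open>
  The \<sigma>-algebra generated by a disjoint sequence \<open>D\<close> in its union consists of the unions
  of subfamilies of \<open>D\<close>, so that \<open>m\<close> becomes a set function \<open>\<nu>\<close> on the subsets of \<open>\<nat>\<close>. For
  \<open>\<phi> : \<nat> \<rightarrow> \<nat>\<close> let \<open>b \<phi>\<close> be the bound \<open>SUP t. a t (\<phi> t)\<close> that the regulator \<open>a\<close> of (s)-boundedness
  supplies. Every infinite \<open>M \<subseteq> \<nat>\<close> contains an infinite \<open>M'\<close> such that \<open>\<nu> B \<le> b \<phi>\<close> for \<^emph>\<open>all\<close>
  \<open>B \<subseteq> M'\<close>: otherwise one cuts \<open>M\<close> into infinitely many infinite pieces and picks in each piece a
  set with \<open>\<not> \<nu> B \<le> b \<phi>\<close>, and these sets form a disjoint sequence that contradicts (s)-boundedness.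
  The bound has to be sought for all subsets of \<open>M'\<close> at once: as \<open>m\<close> is not assumed monotone, a
  bound at \<open>M'\<close> itself would say nothing about them.

  A diagonal argument treats countably many \<open>\<phi>\<close> at once, and countably many suffice: by weak
  \<sigma>-distributivity the \<open>b \<phi>\<close> have infimum 0, and by super Dedekind completeness so do the
  members \<open>c j\<close> of some sequence of them. The diagonal subsequence \<open>E\<close> of \<open>D\<close> then has the property that
  \<open>m\<close> is at most \<open>c j\<close> on all unions of its terms of index above \<open>j\<close>. A decreasing sequence of such
  unions with empty intersection eventually avoids each fixed term of \<open>E\<close>, hence its \<open>m\<close>-values
  eventually fall below \<open>\<sigma> l = (INF j\<in>{..l}. c j)\<close> for each \<open>l\<close>. As \<open>\<sigma>\<close> is an (O)-sequence,
  the double sequence \<open>\<lambda>t. \<sigma>\<close> is a regulator for continuity from above at \<open>\<emptyset>\<close>.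
\<close>

section \<open>Infima along sequences\<close>

text \<open>
  The definition of super Dedekind completeness speaks of suprema; it passes to infima through
  \<open>x \<mapsto> - x\<close>.
\<close>

lemma super_dedekind_complete_Inf_sequence:
  fixes X :: "'r::dedekind_complete_lattice_group set"
  assumes R: "super_dedekind_complete TYPE('r)" and ne: "X \<noteq> {}"
    and lower: "\<And>x. x \<in> X \<Longrightarrow> 0 \<le> x" and Inf: "Inf X = 0"
  shows "\<exists>c::nat \<Rightarrow> 'r. range c \<subseteq> X \<and> (\<forall>y. (\<forall>j. y \<le> c j) \<longrightarrow> y \<le> 0)"
proof -
  have "bdd_above (uminus ` X)"
    using lower by (intro bdd_aboveI[of _ 0]) auto
  then obtain A where A: "A \<subseteq> uminus ` X" "A \<noteq> {}" "countable A" "Sup A = Sup (uminus ` X)"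
    using R ne unfolding super_dedekind_complete_def by (metis image_is_empty)
  have "0 \<le> Sup (uminus ` X)"
  proof -
    have "- Sup (uminus ` X) \<le> x" if "x \<in> X" for x
    proof -
      have "- x \<le> Sup (uminus ` X)"
        using that \<open>bdd_above (uminus ` X)\<close> by (intro cSup_upper) auto
      then show ?thesis
        using neg_le_iff_le[of "Sup (uminus ` X)" "- x"] minus_le_iff by blast
    qed
    then have "- Sup (uminus ` X) \<le> 0"
      using cInf_greatest[OF ne] Inf by metis
    then show ?thesis by simp
  qed
  with A(4) have Sup: "0 \<le> Sup A" by simp
  define c where "c j = - from_nat_into A j" for j
  show ?thesis
  proof (intro exI[of _ c] conjI)
    have "c j \<in> X" for j
    proof -
      have "from_nat_into A j \<in> uminus ` X"
        using A(1) from_nat_into[OF A(2)] by blast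
      then show ?thesis by (auto simp: c_def)
    qed
    then show "range c \<subseteq> X" by blast
  next
    show "\<forall>y. (\<forall>j. y \<le> c j) \<longrightarrow> y \<le> 0"
    proof (intro allI impI)
      fix y assume y: "\<forall>j. y \<le> c j"
      have "x \<le> - y" if x: "x \<in> A" for x
      proof -
        obtain j where "x = from_nat_into A j"
          using from_nat_into_surj[OF A(3) x] by auto
        then show ?thesis
          using spec[OF y, of j] by (simp add: c_def le_minus_iff)
      qed
      then have "Sup A \<le> - y"
        using A(2) by (intro cSup_least)
      with Sup have "0 \<le> - y" by (rule order_trans)
      then show "y \<le> 0" by simp
    qed
  qed
qed

lemma O_sequence_running_INF:
  fixes c :: "nat \<Rightarrow> 'r::dedekind_complete_lattice_group"
  assumes nonneg: "\<And>j. 0 \<le> c j" and Inf: "\<forall>y. (\<forall>j. y \<le> c j) \<longrightarrow> y \<le> 0"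
  shows "O_sequence (\<lambda>l. INF j\<in>{..l}. c j)"
proof -
  let ?\<sigma> = "\<lambda>l. INF j\<in>{..l}. c j"
  have bdd: "bdd_below (c ` J)" for J
    using nonneg by (intro bdd_belowI[of _ 0]) auto
  have "decseq ?\<sigma>"
    using bdd by (auto simp: decseq_def intro!: cINF_superset_mono)
  have nonneg': "0 \<le> ?\<sigma> l" for l
    using nonneg by (intro cINF_greatest) auto
  have bdd': "bdd_below (range ?\<sigma>)"
    using nonneg' by (intro bdd_belowI[of _ 0]) auto
  have "(INF l. ?\<sigma> l) \<le> 0"
  proof (rule Inf[rule_format])
    fix j
    have "(INF l. ?\<sigma> l) \<le> ?\<sigma> j"
      using bdd' by (rule cINF_lower) simp
    also have "\<dots> \<le> c j"
      using bdd by (rule cINF_lower) simp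
    finally show "(INF l. ?\<sigma> l) \<le> c j" .
  qed
  moreover have "0 \<le> (INF l. ?\<sigma> l)"
    by (rule cINF_greatest[OF _ nonneg']) simp
  ultimately show ?thesis
    using \<open>decseq ?\<sigma>\<close> bdd' by (auto simp: O_sequence_def intro: antisym)
qed

lemma O_sequence_nonneg:
  assumes "O_sequence \<sigma>" shows "0 \<le> \<sigma> p"
  using assms cINF_lower[of \<sigma> UNIV p] by (simp add: O_sequence_def)

lemma D_sequence_bdd_above:
  fixes a :: "nat \<Rightarrow> nat \<Rightarrow> 'r::dedekind_complete_lattice_group"
  assumes "D_sequence a"
  shows "bdd_above (range (\<lambda>t. a t (\<phi> t)))"
proof -
  obtain u where "\<And>t l. \<bar>a t l\<bar> \<le> u"
    using assms by (auto simp: D_sequence_def)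
  then have "a t (\<phi> t) \<le> u" for t
    using abs_ge_self order_trans by blast
  then show ?thesis
    by (intro bdd_aboveI[of _ u]) auto
qed

lemma D_sequence_SUP_nonneg:
  fixes a :: "nat \<Rightarrow> nat \<Rightarrow> 'r::dedekind_complete_lattice_group"
  assumes "D_sequence a"
  shows "0 \<le> (SUP t. a t (\<phi> t))"
proof -
  have "0 \<le> a 0 (\<phi> 0)"
    using assms by (auto simp: D_sequence_def intro: O_sequence_nonneg)
  also have "\<dots> \<le> (SUP t. a t (\<phi> t))"
    using D_sequence_bdd_above[OF assms] by (intro cSUP_upper) auto
  finally show ?thesis .
qed

lemma D_sequence_const:
  assumes "O_sequence \<sigma>" shows "D_sequence (\<lambda>t::nat. \<sigma>)"
proof -
  have "\<bar>\<sigma> l\<bar> \<le> \<sigma> 0" for l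
    using assms O_sequence_nonneg[OF assms, of l] by (simp add: O_sequence_def decseq_def)
  then show ?thesis
    using assms unfolding D_sequence_def by blast
qed

section \<open>Sequences all of whose subsets are small\<close>

text \<open>
  Since \<open>Q\<close> is only required for some term of each disjoint sequence, it may fail for some subset of
  each of finitely many disjoint pieces of \<open>s\<close>, but not of infinitely many; the pieces used are the
  rows of a pairing function.
\<close>

lemma subsequence_all_subsets:
  fixes s :: "nat \<Rightarrow> nat"
  assumes Q: "\<And>B::nat \<Rightarrow> nat set. disjoint_family B \<Longrightarrow> \<exists>i. Q (B i)" and s: "strict_mono s"
  shows "\<exists>r::nat \<Rightarrow> nat. strict_mono r \<and> (\<forall>B. B \<subseteq> range (s \<circ> r) \<longrightarrow> Q B)"
proof (rule ccontr)
  assume contra: "\<not> ?thesis"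
  \<comment> \<open>Under the pairing function the rows \<open>range (r i)\<close> partition \<open>\<nat>\<close> into infinite sets.\<close>
  define r where "r i j = prod_encode (i, j)" for i j
  have mono: "strict_mono (r i)" for i
    by (simp add: strict_mono_Suc_iff r_def prod_encode_def)
  then have "\<forall>i. \<exists>B. B \<subseteq> range (s \<circ> r i) \<and> \<not> Q B"
    using contra by blast
  then obtain B where B: "\<And>i. B i \<subseteq> range (s \<circ> r i)" "\<And>i. \<not> Q (B i)"
    by metis
  have "disjoint_family B"
    unfolding disjoint_family_on_def
  proof (intro ballI impI)
    fix i k :: nat assume "i \<noteq> k"
    then have "range (s \<circ> r i) \<inter> range (s \<circ> r k) = {}"
      using strict_mono_eq[OF s] by (auto simp: r_def)
    then show "B i \<inter> B k = {}"
      using B(1)[of i] B(1)[of k] by blast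
  qed
  with Q B(2) show False by blast
qed

text \<open>
  Containment in a range passes to subsequences, so the diagonal sequence retains the \<open>k\<close>-th property
  from the point on where its terms come from the \<open>k\<close>-th refinement. That refinement is made before
  the term of index \<open>k + 1\<close> is chosen, whence the strict bound in \<open>{k<..}\<close>.
\<close>

lemma diagonal_all_subsets:
  assumes Q: "\<And>k B. disjoint_family (B::nat \<Rightarrow> nat set) \<Longrightarrow> \<exists>i. Q k (B i)"
  shows "\<exists>e::nat \<Rightarrow> nat. strict_mono e \<and> (\<forall>k B. B \<subseteq> e ` {k<..} \<longrightarrow> Q k B)"
proof -
  interpret subseqs "\<lambda>k s. \<forall>B. B \<subseteq> range s \<longrightarrow> Q k B"
    using subsequence_all_subsets[OF Q] by unfold_locales
  have *: "\<forall>B. B \<subseteq> range (diagseq \<circ> (+) (Suc k)) \<longrightarrow> Q k B" for k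
    by (rule diagseq_holds) (metis image_comp image_mono subset_UNIV subset_trans)
  have "{k<..} = range ((+) (Suc k))" for k
    by (auto simp: image_iff) presburger
  with * subseq_diagseq show ?thesis
    by (intro exI[of _ diagseq]) (auto simp: image_comp)
qed

section \<open>The \<open>\<sigma>\<close>-algebra generated by a disjoint sequence\<close>

text \<open>
  The sets that contain or avoid each \<open>E i\<close> are closed under the \<sigma>-algebra operations. An empty
  \<open>E i\<close> lies in every \<open>A\<close>; it is left out of the index set so that the index sets of a sequence
  decreasing to \<open>\<emptyset>\<close> decrease to \<open>\<emptyset>\<close> as well.
\<close>

lemma sigma_sets_disjoint_family:
  fixes E :: "nat \<Rightarrow> 'a set"
  assumes disj: "disjoint_family E" and A: "A \<in> sigma_sets (\<Union>i. E i) (range E)"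
  shows "A = (\<Union>i\<in>{i. E i \<noteq> {} \<and> E i \<subseteq> A}. E i)"
proof -
  have dichotomy: "E i \<subseteq> A \<or> E i \<inter> A = {}" for i
    using A
  proof induction
    case (Basic A)
    then obtain k where k: "A = E k" by (rule rangeE)
    then have "i = k \<or> E i \<inter> A = {}"
      using disj by (auto simp: disjoint_family_on_def)
    with k show ?case by blast
  next
    case Empty
    show ?case by simp
  next
    case (Compl A)
    then show ?case by blast
  next
    case (Union A)
    then show ?case by blast
  qed
  show ?thesis
  proof (intro Set.equalityI subsetI)
    fix x assume x: "x \<in> A"
    moreover have "A \<subseteq> (\<Union>i. E i)"
      by (rule sigma_sets_into_sp[OF _ A]) blast
    ultimately obtain i where "x \<in> E i" by blast
    with x dichotomy[of i] show "x \<in> (\<Union>i\<in>{i. E i \<noteq> {} \<and> E i \<subseteq> A}. E i)" by blast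
  qed blast
qed

lemma UN_in_sigma_sets:
  fixes D :: "nat \<Rightarrow> 'a set"
  shows "(\<Union>r\<in>B. D r) \<in> sigma_sets S (range D)"
  by (rule sigma_sets_UNION) auto

lemma decseq_empty_Inter_eventually:
  assumes "decseq H" and "(\<Inter>n. H n) = {}" and "E \<noteq> {}"
  shows "eventually (\<lambda>n. \<not> E \<subseteq> H n) sequentially"
proof -
  obtain n where "\<not> E \<subseteq> H n"
    using assms by blast
  then show ?thesis
    using assms(1) unfolding eventually_sequentially decseq_def by blast
qed

section \<open>Continuity from above at the empty set\<close>

theorem theorem3p8:
  fixes G :: "'g set" and L :: "'g set set"
    and m :: "'g set \<Rightarrow> 'r::dedekind_complete_lattice_group"
  assumes "super_dedekind_complete TYPE('r)"
    and "weakly_sigma_distributive TYPE('r)"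
    and "infinite G"
    and "algebra G L"
    and "property_E L"
    and "positive_bounded L m"
    and "s_bounded L m"
  shows "\<forall>C::nat \<Rightarrow> 'g set. range C \<subseteq> L \<longrightarrow> disjoint_family C \<longrightarrow>
           (\<exists>n::nat \<Rightarrow> nat. strict_mono n \<and>
              sigma_sets (\<Union>h. C (n h)) (range (\<lambda>h. C (n h))) \<subseteq> L \<and>
              continuous_from_above_at_empty_on
                (sigma_sets (\<Union>h. C (n h)) (range (\<lambda>h. C (n h)))) m)"
proof (intro allI impI)
  fix C :: "nat \<Rightarrow> 'g set"
  assume C: "range C \<subseteq> L" "disjoint_family C"
  obtain h :: "nat \<Rightarrow> nat" where h: "strict_mono h"
    and hL: "sigma_sets (\<Union>r. C (h r)) (range (\<lambda>r. C (h r))) \<subseteq> L"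
    using assms(5)[unfolded property_E_def, rule_format, OF C] by (elim exE conjE)
  define D where "D = (\<lambda>r. C (h r))"
  have subfamily_disj: "disjoint_family (\<lambda>i. C (f i))" if "strict_mono f" for f :: "nat \<Rightarrow> nat"
    using C(2) strict_mono_eq[OF that] by (simp add: disjoint_family_on_def)
  have D_disj: "disjoint_family D"
    using subfamily_disj[OF h] by (simp add: D_def)
  have DL: "(\<Union>r\<in>B. D r) \<in> L" for B
    using hL UN_in_sigma_sets[of D B "\<Union>r. D r"] unfolding D_def by blast

  obtain a :: "nat \<Rightarrow> nat \<Rightarrow> 'r" where a: "D_sequence a"
    and a_lim: "\<And>A::nat \<Rightarrow> 'g set. range A \<subseteq> L \<Longrightarrow> disjoint_family A \<Longrightarrow> D_lim a (\<lambda>i. m (A i)) 0"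
    using assms(7) unfolding s_bounded_def by blast
  define b where "b \<phi> = (SUP t. a t (\<phi> t))" for \<phi>
  have b_nonneg: "0 \<le> b \<phi>" for \<phi>
    unfolding b_def by (rule D_sequence_SUP_nonneg[OF a])
  have b_Inf: "Inf (range b) = 0"
    using assms(2) a unfolding weakly_sigma_distributive_def b_def by simp
  have range_b: "range b \<noteq> {}" "\<And>x. x \<in> range b \<Longrightarrow> 0 \<le> x"
    using b_nonneg by auto
  have "\<exists>c::nat \<Rightarrow> 'r. range c \<subseteq> range b \<and> (\<forall>y. (\<forall>j. y \<le> c j) \<longrightarrow> y \<le> 0)"
    using assms(1) range_b b_Inf by (rule super_dedekind_complete_Inf_sequence)
  then obtain c :: "nat \<Rightarrow> 'r" where c: "range c \<subseteq> range b" "\<forall>y. (\<forall>j. y \<le> c j) \<longrightarrow> y \<le> 0"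
    by (elim exE conjE)
  have c_nonneg: "0 \<le> c j" for j
  proof -
    obtain \<phi> where "c j = b \<phi>"
      using c(1) by blast
    with b_nonneg show ?thesis by simp
  qed
  define \<sigma> where "\<sigma> l = (INF j\<in>{..l}. c j)" for l
  have \<sigma>: "O_sequence \<sigma>"
    unfolding \<sigma>_def using c_nonneg c(2) by (rule O_sequence_running_INF)

  have "\<exists>i. m (\<Union>r\<in>B i. D r) \<le> c j" if B: "disjoint_family B" for j and B :: "nat \<Rightarrow> nat set"
  proof -
    have "disjoint_family (\<lambda>i. \<Union>r\<in>B i. D r)"
      unfolding disjoint_family_on_def
    proof (intro ballI impI)
      fix i k :: nat assume "i \<noteq> k"
      then have "B i \<inter> B k = {}"
        using B by (simp add: disjoint_family_on_def)
      moreover have "r = s" if "x \<in> D r" "x \<in> D s" for x r s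
        using D_disj that by (auto simp: disjoint_family_on_def)
      ultimately show "(\<Union>r\<in>B i. D r) \<inter> (\<Union>r\<in>B k. D r) = {}" by blast
    qed
    then have "D_lim a (\<lambda>i. m (\<Union>r\<in>B i. D r)) 0"
      using DL by (intro a_lim) auto
    moreover obtain \<phi> where "c j = b \<phi>"
      using c(1) by blast
    ultimately obtain i where "\<bar>m (\<Union>r\<in>B i. D r)\<bar> \<le> c j"
      unfolding D_lim_def b_def by force
    then show ?thesis
      using abs_ge_self order_trans by blast
  qed
  then have "\<exists>e::nat \<Rightarrow> nat. strict_mono e \<and>
      (\<forall>j B. B \<subseteq> e ` {j<..} \<longrightarrow> m (\<Union>r\<in>B. D r) \<le> c j)"
    by (rule diagonal_all_subsets)
  then obtain e :: "nat \<Rightarrow> nat" where e: "strict_mono e"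
    and small: "\<forall>j B. B \<subseteq> e ` {j<..} \<longrightarrow> m (\<Union>r\<in>B. D r) \<le> c j"
    by (elim exE conjE)

  define E where "E = (\<lambda>i. C ((h \<circ> e) i))"
  let ?\<A> = "sigma_sets (\<Union>i. E i) (range E)"
  have he: "strict_mono (h \<circ> e)"
    using h e by (rule strict_mono_o)
  have E_disj: "disjoint_family E"
    using subfamily_disj[OF he] by (simp add: E_def)
  have E_Union: "(\<Union>i\<in>K. E i) = (\<Union>r\<in>e ` K. D r)" for K
    by (simp add: E_def D_def)
  have \<A>L: "?\<A> \<subseteq> L"
    using sigma_sets_disjoint_family[OF E_disj] DL E_Union by (metis subsetI)
  have "D_lim (\<lambda>t. \<sigma>) (\<lambda>n. m (H n)) 0"
    if H: "range H \<subseteq> ?\<A>" "decseq H" "(\<Inter>n. H n) = {}" for H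
    unfolding D_lim_def
  proof
    fix \<phi> :: "nat \<Rightarrow> nat"
    \<comment> \<open>All rows of the regulator are equal, so the one entry \<open>\<sigma> (\<phi> 0)\<close> already bounds the
      supremum from below.\<close>
    define l where "l = \<phi> 0"
    define K where "K n = {i. E i \<noteq> {} \<and> E i \<subseteq> H n}" for n
    have "eventually (\<lambda>n. i \<notin> K n) sequentially" for i
      using decseq_empty_Inter_eventually[OF H(2,3), of "E i"]
      by (cases "E i = {}") (auto simp: K_def)
    then have "eventually (\<lambda>n. \<forall>i\<in>{..l}. i \<notin> K n) sequentially"
      by (intro eventually_ball_finite) auto
    then obtain n0 where n0: "\<And>n i. n \<ge> n0 \<Longrightarrow> i \<le> l \<Longrightarrow> i \<notin> K n"
      unfolding eventually_sequentially by blast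
    have "\<bar>m (H n) - 0\<bar> \<le> (SUP t. \<sigma> (\<phi> t))" if n: "n \<ge> n0" for n
    proof -
      have Hn: "H n = (\<Union>r\<in>e ` K n. D r)"
        unfolding K_def E_Union[symmetric]
        using H(1) by (intro sigma_sets_disjoint_family[OF E_disj]) auto
      have "m (H n) \<le> c j" if "j \<le> l" for j
      proof -
        have "K n \<subseteq> {j<..}"
          using n0[OF n] that by (meson greaterThan_iff le_trans not_le subsetI)
        then show ?thesis
          unfolding Hn by (intro small[rule_format] image_mono)
      qed
      then have "m (H n) \<le> \<sigma> l"
        unfolding \<sigma>_def by (intro cINF_greatest) auto
      also have "\<sigma> l \<le> (SUP t. \<sigma> (\<phi> t))"
        unfolding l_def
        by (rule cSUP_upper[OF UNIV_I D_sequence_bdd_above[OF D_sequence_const[OF \<sigma>]]])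
      finally have "m (H n) \<le> (SUP t. \<sigma> (\<phi> t))" .
      moreover have "0 \<le> m (H n)"
        using assms(6) H(1) \<A>L unfolding positive_bounded_def by blast
      ultimately show ?thesis by simp
    qed
    then show "\<exists>n0. \<forall>n\<ge>n0. \<bar>m (H n) - 0\<bar> \<le> (SUP t. \<sigma> (\<phi> t))"
      by blast
  qed
  then have "continuous_from_above_at_empty_on ?\<A> m"
    unfolding continuous_from_above_at_empty_on_def
    by (intro exI[of _ "\<lambda>t. \<sigma>"] conjI allI impI D_sequence_const[OF \<sigma>])
  with he \<A>L show "\<exists>n::nat \<Rightarrow> nat. strict_mono n \<and>
      sigma_sets (\<Union>h. C (n h)) (range (\<lambda>h. C (n h))) \<subseteq> L \<and>
      continuous_from_above_at_empty_on (sigma_sets (\<Union>h. C (n h)) (range (\<lambda>h. C (n h)))) m"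
    unfolding E_def by (intro exI[of _ "h \<circ> e"] conjI)
qed

end
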